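(* Let $n\ge1$, let $\sigma_j\in\mathbb{C}$ with $|\sigma_j|=1$ for $1\le j\le n$, and let $Q_j$ and $G_{n,m}$ be defined from $(q_j)_{j=1}^n$ and $(\sigma_j)_{j=1}^n$ as in the context. (i) Let $q_j\in[-q,q]$ for all $1\le j\le n$ and some $0<q<1$. Then $$G_{n,m}\le\frac{1}{\sqrt{1-|Q_{n-m}|^2}},\qquad1\le m\le n.$$ (ii) If additionally $Q_{n-1}=-q_n$ holds, then $$G_{n,m}=\frac{1}{\sqrt{1-|Q_{n-m}|^2}},\qquad1\le m\le n.$$
   Context: Here $Q_0=0$, $Q_1=\frac{q_1}{\sigma_1}$, $Q_j=\frac{q_j+Q_{j-1}}{\sigma_j(1+q_jQ_{j-1})}$ for $2\le j\le n$ (one has $|Q_j|<1$), and $$G_{n,m}:=\left|\prod_{\ell=n-m+1}^{n}\frac{\sqrt{1-q_\ell^2}}{1+q_\ell Q_{\ell-1}}\right|,\qquad1\le m\le n.$$ In the paper, $q_j=\frac{c_{j+1}-c_j}{c_{j+1}+c_j}$ are the relative jumps of a positive piecewise constant wave speed with values $c_j$ on subintervals of length $h_j$, and $\sigma_j=\exp(-2\mathrm{i}h_{j+1}\omega/c_{j+1})$ are phase factors. *)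

theory Defs
  imports Complex_Main
begin

(* Only the values q j and \<sigma> j with 1 \<le> j \<le> n enter Q_0, ..., Q_n and G_{n,m}. *)

fun Q :: "(nat \<Rightarrow> real) \<Rightarrow> (nat \<Rightarrow> complex) \<Rightarrow> nat \<Rightarrow> complex" where
  "Q q \<sigma> 0 = 0"
| "Q q \<sigma> (Suc 0) = complex_of_real (q 1) / \<sigma> 1"
| "Q q \<sigma> (Suc (Suc k)) =
     (complex_of_real (q (k + 2)) + Q q \<sigma> (k + 1)) /
     (\<sigma> (k + 2) * (1 + complex_of_real (q (k + 2)) * Q q \<sigma> (k + 1)))"

definition G :: "(nat \<Rightarrow> real) \<Rightarrow> (nat \<Rightarrow> complex) \<Rightarrow> nat \<Rightarrow> nat \<Rightarrow> real" where
  "G q \<sigma> n m =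
     cmod (\<Prod>l = n - m + 1..n.
       complex_of_real (sqrt (1 - (q l)\<^sup>2)) / (1 + complex_of_real (q l) * Q q \<sigma> (l - 1)))"

end

theory Submission
  imports Defs
begin

text \<open>
  The identity \<open>\<bar>1 + a z\<bar>\<^sup>2 - \<bar>a + z\<bar>\<^sup>2 = (1 - a\<^sup>2) (1 - \<bar>z\<bar>\<^sup>2)\<close> for real \<open>a\<close> shows that each factor
  of \<open>G\<close> has modulus \<open>sqrt (1 - \<bar>Q\<^sub>l\<bar>\<^sup>2) / sqrt (1 - \<bar>Q\<^sub>l\<^sub>-\<^sub>1\<bar>\<^sup>2)\<close>. The product therefore telescopes, and
  only the numerator \<open>sqrt (1 - \<bar>Q\<^sub>n\<bar>\<^sup>2)\<close> remains to be compared with 1.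
\<close>

text \<open>Since \<open>Q q \<sigma> 0 = 0\<close>, the general step collapses to
  \<open>q 1 / \<sigma> 1\<close> at index 1, so a single recurrence covers both defining
  cases.\<close>

lemma Q_Suc:
  "Q q \<sigma> (Suc k) = (complex_of_real (q (Suc k)) + Q q \<sigma> k) /
     (\<sigma> (Suc k) * (1 + complex_of_real (q (Suc k)) * Q q \<sigma> k))"
  by (cases k) auto

text \<open>Both squared moduli expand with the same cross term \<open>2 * a * Re z\<close>, which
  cancels.\<close>

lemma cmod_moebius_identity:
  "(cmod (1 + complex_of_real a * z))\<^sup>2 - (cmod (complex_of_real a + z))\<^sup>2
     = (1 - a\<^sup>2) * (1 - (cmod z)\<^sup>2)"
  by (simp add: cmod_power2) algebra

lemma moebius_denom_nonzero:
  assumes "\<bar>a\<bar> < 1" "cmod z < 1"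
  shows "1 + complex_of_real a * z \<noteq> 0"
proof
  assume "1 + complex_of_real a * z = 0"
  then have "cmod (complex_of_real a * z) = 1"
    by (simp add: add_eq_0_iff)
  moreover have "\<bar>a\<bar> * cmod z < 1 * 1"
    using assms by (intro mult_strict_mono') auto
  ultimately show False
    by (simp add: norm_mult)
qed

text \<open>Divide the identity by the squared modulus of the denominator; the phase
  \<open>\<sigma> (Suc k)\<close> has modulus 1 and drops out.\<close>

lemma one_minus_cmod_Q_Suc:
  assumes "cmod (\<sigma> (Suc k)) = 1" "1 + complex_of_real (q (Suc k)) * Q q \<sigma> k \<noteq> 0"
  shows "1 - (cmod (Q q \<sigma> (Suc k)))\<^sup>2 = (1 - (q (Suc k))\<^sup>2) * (1 - (cmod (Q q \<sigma> k))\<^sup>2)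
           / (cmod (1 + complex_of_real (q (Suc k)) * Q q \<sigma> k))\<^sup>2"
  unfolding Q_Suc using assms
  by (simp add: norm_divide norm_mult power_divide cmod_moebius_identity[symmetric]
      diff_divide_distrib)

text \<open>Each step is a Moebius map of the unit disc into itself followed by a rotation. Staying
  strictly inside keeps the denominators nonzero and the later square roots positive.\<close>

lemma cmod_Q_less_1:
  assumes "\<And>j. 1 \<le> j \<Longrightarrow> j \<le> n \<Longrightarrow> cmod (\<sigma> j) = 1"
    and "\<And>j. 1 \<le> j \<Longrightarrow> j \<le> n \<Longrightarrow> \<bar>q j\<bar> < 1"
    and "k \<le> n"
  shows "cmod (Q q \<sigma> k) < 1"
  using \<open>k \<le> n\<close>
proof (induction k)
  case 0
  then show ?case by simp
next
  case (Suc k)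
  then have IH: "cmod (Q q \<sigma> k) < 1" and s: "cmod (\<sigma> (Suc k)) = 1" and a: "\<bar>q (Suc k)\<bar> < 1"
    using assms by auto
  have nz: "1 + complex_of_real (q (Suc k)) * Q q \<sigma> k \<noteq> 0"
    using a IH by (rule moebius_denom_nonzero)
  have "0 < 1 - (cmod (Q q \<sigma> (Suc k)))\<^sup>2"
    unfolding one_minus_cmod_Q_Suc[OF s nz] using IH a nz
    by (simp add: abs_square_less_1)
  then show ?case
    by (simp add: abs_square_less_1)
qed

text \<open>The upper limit \<open>i\<close> is kept separate from \<open>n\<close>, so that
  induction can append one factor at a time.\<close>

lemma cmod_prod_telescope:
  assumes "\<And>j. 1 \<le> j \<Longrightarrow> j \<le> n \<Longrightarrow> cmod (\<sigma> j) = 1"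
    and "\<And>j. 1 \<le> j \<Longrightarrow> j \<le> n \<Longrightarrow> \<bar>q j\<bar> < 1"
    and "k \<le> i" "i \<le> n"
  shows "cmod (\<Prod>l = k + 1..i. complex_of_real (sqrt (1 - (q l)\<^sup>2)) /
             (1 + complex_of_real (q l) * Q q \<sigma> (l - 1)))
         = sqrt (1 - (cmod (Q q \<sigma> i))\<^sup>2) / sqrt (1 - (cmod (Q q \<sigma> k))\<^sup>2)"
  using \<open>k \<le> i\<close> \<open>i \<le> n\<close>
proof (induction i rule: dec_induct)
  case base
  \<comment> \<open>The empty product is 1, while the right side is a quotient of equal terms, which
    is 1 only if they are nonzero.\<close>
  then have "(cmod (Q q \<sigma> k))\<^sup>2 < 1"
    using cmod_Q_less_1[of n \<sigma> q k] assms by (simp add: abs_square_less_1)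
  then show ?case by simp
next
  case (step i)
  have s: "cmod (\<sigma> (Suc i)) = 1" and a: "\<bar>q (Suc i)\<bar> < 1" and Qi: "cmod (Q q \<sigma> i) < 1"
    using assms step.prems cmod_Q_less_1[of n \<sigma> q i] by auto
  \<comment> \<open>The first fact lets the old numerator cancel against the denominator of the new
    factor.\<close>
  have pos: "0 < 1 - (cmod (Q q \<sigma> i))\<^sup>2" "0 < 1 - (q (Suc i))\<^sup>2"
    using Qi a by (simp_all add: abs_square_less_1)
  note nz = moebius_denom_nonzero[OF a Qi]
  show ?case
    using step pos
    by (simp add: one_minus_cmod_Q_Suc[OF s nz] norm_mult norm_divide real_sqrt_mult
        real_sqrt_divide mult.commute)
qed

lemma G_eq:
  assumes "\<And>j. 1 \<le> j \<Longrightarrow> j \<le> n \<Longrightarrow> cmod (\<sigma> j) = 1"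
    and "\<And>j. 1 \<le> j \<Longrightarrow> j \<le> n \<Longrightarrow> \<bar>q j\<bar> < 1"
  shows "G q \<sigma> n m = sqrt (1 - (cmod (Q q \<sigma> n))\<^sup>2) / sqrt (1 - (cmod (Q q \<sigma> (n - m)))\<^sup>2)"
  unfolding G_def using assms by (intro cmod_prod_telescope[of n]) auto

theorem lemma9:
  fixes n :: nat and q :: "nat \<Rightarrow> real" and \<sigma> :: "nat \<Rightarrow> complex" and qmax :: real
  assumes n: "n \<ge> 1"
    and sigma: "\<And>j. 1 \<le> j \<Longrightarrow> j \<le> n \<Longrightarrow> cmod (\<sigma> j) = 1"
    and qmax: "0 < qmax" "qmax < 1"
    and q: "\<And>j. 1 \<le> j \<Longrightarrow> j \<le> n \<Longrightarrow> q j \<in> {-qmax..qmax}"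
  shows "(\<forall>m. 1 \<le> m \<and> m \<le> n \<longrightarrow>
            G q \<sigma> n m \<le> 1 / sqrt (1 - (cmod (Q q \<sigma> (n - m)))\<^sup>2)) \<and>
         (Q q \<sigma> (n - 1) = - complex_of_real (q n) \<longrightarrow>
            (\<forall>m. 1 \<le> m \<and> m \<le> n \<longrightarrow>
               G q \<sigma> n m = 1 / sqrt (1 - (cmod (Q q \<sigma> (n - m)))\<^sup>2)))"
proof -
  have q': "\<bar>q j\<bar> < 1" if "1 \<le> j" "j \<le> n" for j
    using q[OF that] qmax by auto
  have G: "G q \<sigma> n m = sqrt (1 - (cmod (Q q \<sigma> n))\<^sup>2) / sqrt (1 - (cmod (Q q \<sigma> (n - m)))\<^sup>2)" for m
    using sigma q' by (rule G_eq)
  have Q1: "(cmod (Q q \<sigma> k))\<^sup>2 < 1" if "k \<le> n" for k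
    using cmod_Q_less_1[of n \<sigma> q k] sigma q' that by (simp add: abs_square_less_1)
  \<comment> \<open>The telescoped numerator is the square root of a number at most 1.\<close>
  have "G q \<sigma> n m \<le> 1 / sqrt (1 - (cmod (Q q \<sigma> (n - m)))\<^sup>2)" for m
    unfolding G using Q1[of "n - m"] by (intro divide_right_mono) auto
  moreover have "G q \<sigma> n m = 1 / sqrt (1 - (cmod (Q q \<sigma> (n - m)))\<^sup>2)"
    if "Q q \<sigma> (n - 1) = - complex_of_real (q n)" for m
  proof -
    \<comment> \<open>The condition annihilates the numerator of the last recurrence step, so the
      telescoped numerator equals 1.\<close>
    have "Q q \<sigma> n = 0"
      using Q_Suc[of q \<sigma> "n - 1"] n that by simp
    then show ?thesis
      unfolding G by simp
  qed
  ultimately show ?thesis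
    by blast
qed

end
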